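(* In the bit-probe model for the greater-than problem on $[0..n-1]$, the achievable update cost $T_u$ and query cost $T_q$ satisfy the following tight tradeoffs: in the regime $T_q \geq \lg\lg n$, $T_u \leq \lg n$, one has $T_u = \Theta(\lg_{T_q} n)$; in the regime $T_q \leq \lg\lg n$, $T_u \geq \lg n$, one has $2^{T_q} = \Theta(\lg_{T_u} n)$.
   Context: The greater-than problem in the bit-probe model: memory is an infinite array of bits, initially all zero. In the update stage, the algorithm receives a number $a \in [0..n-1]$ and may then flip $O(T_u)$ bits of the memory. In the query stage, the algorithm receives a number $b \in [0..n-1]$, may inspect (adaptively) $O(T_q)$ bits of the memory, and must decide correctly whether $b > a$. $\lg$ denotes the base-2 logarithm and $\lg_B$ the base-$B$ logarithm. "Tight tradeoff" means that these relations are both achievable by some scheme and necessary for every scheme, up to constant factors.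
   Formalization: In the regime T_q ≤ lg lg n, necessity is stated for the actual number q = O(T_q) of inspected bits, as 2^q = Ω(lg_{T_u} n), since with O(T_q) probes the bound on 2^{T_q} itself fails (T_u = lg n, T_q = ½ lg lg n); achievability is with O(T_q) probes. *)

theory Defs
  imports Complex_Main "HOL-Library.Landau_Symbols"
begin

type_synonym memory = "nat \<Rightarrow> bool"

definition zero_memory :: memory where
  "zero_memory = (\<lambda>_. False)"

definition flip_bits :: "nat set \<Rightarrow> memory \<Rightarrow> memory" where
  "flip_bits S m = (\<lambda>i. if i \<in> S then \<not> m i else m i)"

text \<open>Adaptive query algorithms are binary decision trees: \<open>Probe i l r\<close> inspects bit \<open>i\<close> and
  continues with \<open>l\<close> if it is 0 and with \<open>r\<close> if it is 1.\<close>

datatype query_alg = Answer bool | Probe nat query_alg query_alg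

primrec run :: "query_alg \<Rightarrow> memory \<Rightarrow> bool" where
  "run (Answer v) m = v"
| "run (Probe i l r) m = (if m i then run r m else run l m)"

primrec probes :: "query_alg \<Rightarrow> memory \<Rightarrow> nat" where
  "probes (Answer v) m = 0"
| "probes (Probe i l r) m = Suc (if m i then probes r m else probes l m)"

text \<open>The update always starts from the all-zero memory, so there is nothing for it to learn by
  reading, and it is given by the finite set \<open>U a\<close> of bits that it flips on input \<open>a\<close>.\<close>

definition gt_scheme ::
  "nat \<Rightarrow> nat \<Rightarrow> nat \<Rightarrow> (nat \<Rightarrow> nat set) \<Rightarrow> (nat \<Rightarrow> query_alg) \<Rightarrow> bool" where
  "gt_scheme n u q U Q \<longleftrightarrow>
     (\<forall>a<n. finite (U a) \<and> card (U a) \<le> u) \<and>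
     (\<forall>a<n. \<forall>b<n.
        probes (Q b) (flip_bits (U a) zero_memory) \<le> q \<and>
        (run (Q b) (flip_bits (U a) zero_memory) \<longleftrightarrow> b > a))"

text \<open>A family of schemes, one for every universe size \<open>n\<close>, with exact worst-case costs:
  at most \<open>u n\<close> flips and at most \<open>q n\<close> probes.\<close>

definition gt_costs :: "(nat \<Rightarrow> nat) \<Rightarrow> (nat \<Rightarrow> nat) \<Rightarrow> bool" where
  "gt_costs u q \<longleftrightarrow> (\<forall>n. \<exists>U Q. gt_scheme n (u n) (q n) U Q)"

definition gt_achievable :: "(nat \<Rightarrow> real) \<Rightarrow> (nat \<Rightarrow> real) \<Rightarrow> bool" where
  "gt_achievable Tu Tq \<longleftrightarrow>
     (\<exists>u q. gt_costs u q \<and> (\<lambda>n. real (u n)) \<in> O(Tu) \<and> (\<lambda>n. real (q n)) \<in> O(Tq))"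

end

theory Submission
  imports Defs "HOL-Library.Nat_Bijection"
begin

text \<open>Lower bound for few flips: \<open>n \<le> (2 * q + 2) ^ u\<close>. Run the median query on the unflipped memory;
  its answer there is wrong for about half of the updates, so each of these flips one of the first
  \<open>q\<close> cells that it reads. Restrict to the most popular such cell and count it as already
  flipped.

  Lower bound for few probes: \<open>n \<le> (8 * u + 4) ^ (2 ^ q)\<close>. If many queries share their first
  cell, keep those queries and the updates that agree on this cell. Otherwise there are many queries
  with distinct first cells; since an update flips at most \<open>u\<close> of these, a large set of inputs has
  all its first probes unflipped. Either way one probe is saved, while the universe shrinks
  roughly to its square root.

  Upper bounds: mark the path to \<open>a\<close> in a \<open>B\<close>-ary trie. A query finds by binary search where \<open>b\<close>
  leaves that path. It then either scans the smaller siblings at this point, or reads a single bit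
  if the update has also marked all larger siblings along its path.\<close>

section \<open>Lower bound for schemes with few flips\<close>

primrec probed :: "query_alg \<Rightarrow> memory \<Rightarrow> nat list" where
  "probed (Answer v) m = []"
| "probed (Probe i l r) m = i # (if m i then probed r m else probed l m)"

text \<open>The probe bound is assumed only for \<open>m'\<close>: on \<open>m\<close>, which need
  not arise from any update, the tree may read more cells. The two runs stay together for
  \<open>q\<close> steps, and by then the run on \<open>m'\<close> has ended.\<close>

lemma run_cong_take_probed:
  assumes "\<forall>i \<in> set (take q (probed t m)). m' i = m i" "probes t m' \<le> q"
  shows "run t m' = run t m"
  using assms
proof (induction t arbitrary: q)
  case (Probe i l r)
  then obtain q' where q: "q = Suc q'"
    by (cases q) auto
  show ?case
    using Probe.prems Probe.IH(1)[of q'] Probe.IH(2)[of q'] by (auto simp: q split: if_splits)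
qed auto

text \<open>Adding the elements in increasing order keeps the ranks of the earlier ones, and each
  new maximum gets the next rank.\<close>

lemma exists_element_of_rank:
  fixes S :: "'a::linorder set"
  assumes "finite S" "k < card S"
  shows "\<exists>b\<in>S. card {a\<in>S. a < b} = k"
  using assms
proof (induction S rule: finite_linorder_max_induct)
  case (insert b A)
  show ?case
  proof (cases "k < card A")
    case True
    then obtain b' where b': "b' \<in> A" "card {a\<in>A. a < b'} = k"
      using insert.IH by blast
    moreover have "{a \<in> insert b A. a < b'} = {a\<in>A. a < b'}"
      using insert.hyps b' by (auto dest: order.asym)
    ultimately show ?thesis by (intro bexI[of _ b']) auto
  next
    case False
    have "b \<notin> A" using insert.hyps by auto
    then have "card A = k" using False insert by auto
    moreover have "{a \<in> insert b A. a < b} = A"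
      using insert.hyps by auto
    ultimately show ?thesis by (intro bexI[of _ b]) auto
  qed
qed simp

text \<open>Pigeonhole in counting form. The classes are the updates that flip a given cell in one
  lower bound, the queries with a given first cell in the other.\<close>

lemma card_le_of_cover:
  assumes "finite C" "finite S" "\<And>a. a \<in> S \<Longrightarrow> \<exists>i\<in>C. P i a"
    and "\<And>i. i \<in> C \<Longrightarrow> card {a\<in>S. P i a} \<le> G"
  shows "card S \<le> card C * G"
proof -
  have "S \<subseteq> (\<Union>i\<in>C. {a\<in>S. P i a})"
    using assms(3) by blast
  then have "card S \<le> card (\<Union>i\<in>C. {a\<in>S. P i a})"
    using assms by (intro card_mono) auto
  also have "\<dots> \<le> (\<Sum>i\<in>C. card {a\<in>S. P i a})"
    using assms(1) by (rule card_UN_le)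
  also have "\<dots> \<le> card C * G"
    using sum_bounded_above[of C "\<lambda>i. card {a\<in>S. P i a}" G] assms(4) by simp
  finally show ?thesis .
qed

text \<open>\<open>m\<close> is arbitrary so that the induction on \<open>u\<close> goes through: a
  cell flipped by all remaining updates moves from \<open>U a\<close> into \<open>m\<close>, which
  leaves the actual memories unchanged and uses up one flip.\<close>

lemma card_le_if_probes_le:
  fixes S :: "'a::linorder set"
  assumes "finite S"
    and "\<And>a. a \<in> S \<Longrightarrow> finite (U a) \<and> card (U a) \<le> u"
    and "\<And>a b. a \<in> S \<Longrightarrow> b \<in> S \<Longrightarrow> probes (Q b) (flip_bits (U a) m) \<le> q"
    and "\<And>a b. a \<in> S \<Longrightarrow> b \<in> S \<Longrightarrow> run (Q b) (flip_bits (U a) m) \<longleftrightarrow> b > a"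
  shows "card S \<le> (2 * q + 2) ^ u"
  using assms
proof (induction u arbitrary: S U m)
  case 0
  have mem: "flip_bits (U a) m = m" if "a \<in> S" for a
    using "0.prems"(2)[OF that] by (auto simp: flip_bits_def)
  have "a = b" if "a \<in> S" "b \<in> S" for a b
    using "0.prems"(4) mem that by (metis linorder_neqE less_irrefl)
  then show ?case
    using \<open>finite S\<close> by (simp add: card_le_Suc0_iff_eq)
next
  case (Suc u)
  show ?case
  proof (cases "S = {}")
    case False
    define G where "G = (2 * q + 2) ^ u"
    obtain b where b: "b \<in> S" "card {a\<in>S. a < b} = card S div 2"
      using exists_element_of_rank[of S "card S div 2"] False Suc.prems(1)
      by (metis card_gt_0_iff div_less_dividend one_less_numeral_iff semiring_norm(76))
    define C where "C = set (take q (probed (Q b) m))"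
    have C: "finite C" "card C \<le> q"
      unfolding C_def by (auto intro: order.trans[OF card_length])
    \<comment> \<open>The inputs on which the answer for the unflipped memory is wrong.\<close>
    define S' where "S' = (if run (Q b) m then {a\<in>S. b \<le> a} else {a\<in>S. a < b})"
    have S': "S' \<subseteq> S" "finite S'"
      using Suc.prems(1) by (auto simp: S'_def)
    have "card S = card ({a\<in>S. a < b} \<union> {a\<in>S. b \<le> a})"
      by (rule arg_cong[where f = card]) auto
    also have "\<dots> = card {a\<in>S. a < b} + card {a\<in>S. b \<le> a}"
      using Suc.prems(1) by (intro card_Un_disjoint) auto
    finally have half: "card S \<le> 2 * card S' + 1"
      using b(2) by (auto simp: S'_def)
    have hit: "\<exists>i\<in>C. i \<in> U a" if "a \<in> S'" for a
    proof (rule ccontr)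
      assume "\<not> (\<exists>i\<in>C. i \<in> U a)"
      then have "\<forall>i\<in>set (take q (probed (Q b) m)). flip_bits (U a) m i = m i"
        by (simp add: C_def flip_bits_def)
      moreover have "probes (Q b) (flip_bits (U a) m) \<le> q"
        using Suc.prems(3) that S' b(1) by blast
      ultimately have "run (Q b) (flip_bits (U a) m) = run (Q b) m"
        by (rule run_cong_take_probed)
      then show False
        using Suc.prems(4)[of a b] that b(1) by (auto simp: S'_def split: if_splits)
    qed
    have "card {a\<in>S'. i \<in> U a} \<le> G" for i
      unfolding G_def
    proof (rule Suc.IH[where U = "\<lambda>a. U a - {i}" and m = "flip_bits {i} m"])
      have eq: "flip_bits (U a - {i}) (flip_bits {i} m) = flip_bits (U a) m" if "i \<in> U a" for a
        using that by (auto simp: flip_bits_def)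
      show "finite {a\<in>S'. i \<in> U a}" using S' by auto
      show "finite (U a - {i}) \<and> card (U a - {i}) \<le> u" if "a \<in> {a\<in>S'. i \<in> U a}" for a
        using Suc.prems(2)[OF subsetD[OF S'(1)], of a] that by (auto simp: card_Diff_singleton)
      show "probes (Q b) (flip_bits (U a - {i}) (flip_bits {i} m)) \<le> q"
        if "a \<in> {a\<in>S'. i \<in> U a}" "b \<in> {a\<in>S'. i \<in> U a}" for a b
        using Suc.prems(3)[OF subsetD subsetD, OF S'(1) _ S'(1), of a b] that by (simp add: eq)
      show "run (Q b) (flip_bits (U a - {i}) (flip_bits {i} m)) \<longleftrightarrow> b > a"
        if "a \<in> {a\<in>S'. i \<in> U a}" "b \<in> {a\<in>S'. i \<in> U a}" for a b
        using Suc.prems(4)[OF subsetD subsetD, OF S'(1) _ S'(1), of a b] that by (simp add: eq)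
    qed
    then have "card S' \<le> card C * G"
      using C S' hit by (intro card_le_of_cover[where P = "\<lambda>i a. i \<in> U a"]) auto
    also have "\<dots> \<le> q * G" using C by simp
    finally have "card S \<le> 2 * (q * G) + 1" using half by simp
    \<comment> \<open>The \<open>1\<close> lost by rounding at the median is absorbed by
      \<open>2 * G\<close>, whence the \<open>+ 2\<close> in the base.\<close>
    also have "\<dots> \<le> 2 * (q * G) + 2 * G"
      using one_le_power[of "2 * q + 2" u] by (simp add: G_def)
    finally show ?thesis by (simp add: G_def algebra_simps)
  qed simp
qed

section \<open>Lower bound for schemes with few probes\<close>

text \<open>Averaging gives a vertex of in-degree at most \<open>u\<close>; keep it, delete its at most \<open>2 * u\<close>
  neighbours, and repeat.\<close>

lemma exists_independent_subset:
  assumes "finite R" "\<And>a. a \<in> R \<Longrightarrow> card {b\<in>R. E a b} \<le> u"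
  shows "\<exists>T\<subseteq>R. (\<forall>a\<in>T. \<forall>b\<in>T. a \<noteq> b \<longrightarrow> \<not> E a b) \<and> card R \<le> (2 * u + 1) * card T"
  using assms
proof (induction R rule: finite_psubset_induct)
  case (psubset R)
  show ?case
  proof (cases "R = {}")
    case False
    have "\<exists>v\<in>R. card {a\<in>R. E a v} \<le> u"
    proof (rule ccontr)
      assume "\<not> ?thesis"
      then have "(\<Sum>v\<in>R. u) < (\<Sum>v\<in>R. card {a\<in>R. E a v})"
        using psubset.hyps False by (intro sum_strict_mono) auto
      \<comment> \<open>Double counting of arcs: in-degrees and out-degrees have the same
        sum.\<close>
      also have "\<dots> = (\<Sum>a\<in>R. card {v\<in>R. E a v})"
        using psubset.hyps sum.swap_restrict[of R R "\<lambda>_ _. 1 :: nat" "\<lambda>v a. E a v"] by simp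
      also have "\<dots> \<le> (\<Sum>v\<in>R. u)"
        using psubset.prems by (intro sum_mono) auto
      finally show False by simp
    qed
    then obtain v where v: "v \<in> R" "card {a\<in>R. E a v} \<le> u" by blast
    define N where "N = {v} \<union> ({a\<in>R. E a v} \<union> {b\<in>R. E v b})"
    have N: "N \<subseteq> R" "v \<in> N" using v by (auto simp: N_def)
    have "card N \<le> 1 + (u + u)"
      unfolding N_def using v psubset.prems[of v]
      by (intro order.trans[OF card_Un_le] add_mono) auto
    moreover have "\<exists>T\<subseteq>R - N. (\<forall>a\<in>T. \<forall>b\<in>T. a \<noteq> b \<longrightarrow> \<not> E a b)
        \<and> card (R - N) \<le> (2 * u + 1) * card T"
    proof (rule psubset.IH)
      show "R - N \<subset> R" using N by blast
      show "card {b \<in> R - N. E a b} \<le> u" if "a \<in> R - N" for a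
        using psubset.hyps psubset.prems[of a] that
        by (auto intro: order.trans[OF card_mono[of "{b\<in>R. E a b}"]])
    qed
    then obtain T where T: "T \<subseteq> R - N" "\<forall>a\<in>T. \<forall>b\<in>T. a \<noteq> b \<longrightarrow> \<not> E a b"
      "card (R - N) \<le> (2 * u + 1) * card T" by blast
    have "card R = card N + card (R - N)"
      using N psubset.hyps by (metis card_Diff_subset card_mono finite_subset le_add_diff_inverse)
    moreover have "finite T" "v \<notin> T" using T N psubset.hyps by (auto intro: finite_subset)
    ultimately have "card R \<le> (2 * u + 1) * card (insert v T)"
      using T \<open>card N \<le> 1 + (u + u)\<close> by simp
    moreover have "\<forall>a\<in>insert v T. \<forall>b\<in>insert v T. a \<noteq> b \<longrightarrow> \<not> E a b"
      using T v by (auto simp: N_def)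
    moreover have "insert v T \<subseteq> R" using T v by auto
    ultimately show ?thesis by blast
  qed simp
qed

text \<open>A tree that is a bare answer gets the dummy cell \<open>0\<close>; this is harmless
  because \<open>after_first\<close> leaves such a tree unchanged.\<close>

definition first_cell :: "query_alg \<Rightarrow> nat" where
  "first_cell t = (case t of Answer _ \<Rightarrow> 0 | Probe i _ _ \<Rightarrow> i)"

definition after_first :: "bool \<Rightarrow> query_alg \<Rightarrow> query_alg" where
  "after_first c t = (case t of Answer v \<Rightarrow> Answer v | Probe _ l r \<Rightarrow> if c then r else l)"

lemma after_first:
  assumes "m (first_cell t) = c"
  shows "run (after_first c t) m = run t m" "probes (after_first c t) m = probes t m - 1"
  using assms by (auto simp: first_cell_def after_first_def split: query_alg.splits)

text \<open>Correctness is only required for \<open>a \<noteq> b\<close>: when the first probe is eliminated, nothing is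
  known about the first cell of \<open>Q a\<close> in the memory for \<open>a\<close> itself.\<close>

lemma card_le_if_flips_le:
  fixes S :: "'a::linorder set"
  assumes "finite S"
    and "\<And>a. a \<in> S \<Longrightarrow> finite (U a) \<and> card (U a) \<le> u"
    and "\<And>a b. a \<in> S \<Longrightarrow> b \<in> S \<Longrightarrow> a \<noteq> b \<Longrightarrow> probes (Q b) (flip_bits (U a) m) \<le> q"
    and "\<And>a b. a \<in> S \<Longrightarrow> b \<in> S \<Longrightarrow> a \<noteq> b \<Longrightarrow> run (Q b) (flip_bits (U a) m) \<longleftrightarrow> b > a"
  shows "(4 * u + 2) * card S \<le> (8 * u + 4) ^ (2 ^ q)"
  using assms
proof (induction q arbitrary: S Q)
  case 0
  \<comment> \<open>Without probes every answer is constant, but a query strictly between two inputs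
    must give both answers.\<close>
  have "card S \<le> 2"
  proof (rule ccontr)
    assume "\<not> card S \<le> 2"
    then have "1 < card S" "2 < card S" by auto
    then obtain b where b: "b \<in> S" "card {a\<in>S. a < b} = 1"
      using exists_element_of_rank[of S 1] 0 by blast
    then obtain a where a: "a \<in> S" "a < b"
      by (metis (no_types, lifting) card_1_singletonE insertI1 mem_Collect_eq)
    have "\<not> S \<subseteq> insert b {a\<in>S. a < b}"
    proof
      assume "S \<subseteq> insert b {a\<in>S. a < b}"
      then have "card S \<le> card (insert b {a\<in>S. a < b})"
        using 0 by (intro card_mono) auto
      also have "\<dots> \<le> Suc (card {a\<in>S. a < b})" by (rule card_insert_le_m1) auto
      finally show False using b \<open>2 < card S\<close> by simp
    qed
    then obtain c where "c \<in> S" "c \<noteq> b" "\<not> c < b" by blast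
    then have c: "c \<in> S" "b < c" by auto
    have "run (Q b) (flip_bits (U a) m) = run (Q b) (flip_bits (U c) m)"
      using "0.prems"(3)[of a b] a b by (cases "Q b") auto
    then show False
      using "0.prems"(4)[of a b] "0.prems"(4)[of c b] a b c by auto
  qed
  then have "(4 * u + 2) * card S \<le> (4 * u + 2) * 2"
    by (intro mult_le_mono2)
  then show ?case by simp
next
  case (Suc q)
  let ?f = "\<lambda>b. first_cell (Q b)"
  let ?mem = "\<lambda>a. flip_bits (U a) m"
  \<comment> \<open>The weight \<open>4 * u + 2\<close> turns the recursion into squaring: there
    will be at most \<open>F / 2\<close> distinct first cells, each shared by at most
    \<open>2 * F / (4 * u + 2)\<close> queries.\<close>
  define F where "F = (8 * u + 4) ^ (2 ^ q)"
  \<comment> \<open>If the first cell of \<open>Q b\<close> holds a value \<open>c b\<close> that is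
    the same for all other inputs in \<open>T\<close>, its probe can be hardwired.\<close>
  have reduce: "(4 * u + 2) * card T \<le> F"
    if "T \<subseteq> S" and c: "\<And>a b. a \<in> T \<Longrightarrow> b \<in> T \<Longrightarrow> a \<noteq> b \<Longrightarrow> ?mem a (?f b) = c b" for T c
    unfolding F_def
  proof (rule Suc.IH[where Q = "\<lambda>b. after_first (c b) (Q b)"])
    show "finite T" using that Suc.prems(1) finite_subset by blast
    show "finite (U a) \<and> card (U a) \<le> u" if "a \<in> T" for a
      using that \<open>T \<subseteq> S\<close> Suc.prems(2) by blast
    show "probes (after_first (c b) (Q b)) (?mem a) \<le> q" if "a \<in> T" "b \<in> T" "a \<noteq> b" for a b
      using Suc.prems(3)[of a b] after_first(2)[of "?mem a" "Q b" "c b"] c[of a b] that \<open>T \<subseteq> S\<close>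
      by (simp add: subset_eq)
    show "run (after_first (c b) (Q b)) (?mem a) \<longleftrightarrow> b > a" if "a \<in> T" "b \<in> T" "a \<noteq> b" for a b
      using Suc.prems(4)[of a b] after_first(1)[of "?mem a" "Q b" "c b"] c[of a b] that \<open>T \<subseteq> S\<close>
      by (simp add: subset_eq)
  qed
  have "(4 * u + 2) * card {b\<in>S. ?f b = i} \<le> 2 * F" for i
  proof -
    \<comment> \<open>All these queries start at cell \<open>i\<close>. Their indices, now read as
      inputs, are split by the content that their updates give to this cell.\<close>
    have "{b\<in>S. ?f b = i} = {b\<in>S. ?f b = i \<and> ?mem b i} \<union> {b\<in>S. ?f b = i \<and> \<not> ?mem b i}"
      by auto
    then have "card {b\<in>S. ?f b = i} \<le>
        card {b\<in>S. ?f b = i \<and> ?mem b i} + card {b\<in>S. ?f b = i \<and> \<not> ?mem b i}"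
      by (metis (no_types, lifting) card_Un_le)
    then have "(4 * u + 2) * card {b\<in>S. ?f b = i} \<le>
        (4 * u + 2) * (card {b\<in>S. ?f b = i \<and> ?mem b i} + card {b\<in>S. ?f b = i \<and> \<not> ?mem b i})"
      by (rule mult_le_mono2)
    also have "\<dots> \<le> F + F"
      unfolding distrib_left by (intro add_mono reduce[of _ "\<lambda>_. True"] reduce[of _ "\<lambda>_. False"]) auto
    finally show ?thesis by simp
  qed
  then have fibre: "card {b\<in>S. ?f b = i} \<le> 2 * F div (4 * u + 2)" for i
    by (simp add: less_eq_div_iff_mult_less_eq mult.commute)
  \<comment> \<open>\<open>R\<close> has one representative per first cell, so an update with at
    most \<open>u\<close> flips hits the first cells of at most \<open>u\<close> of its
    members.\<close>
  obtain R where R: "R \<subseteq> S" "inj_on ?f R" "?f ` S = ?f ` R"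
    using subset_image_inj[of "?f ` S" ?f S] by auto
  have "finite R" using R Suc.prems(1) finite_subset by blast
  have "card {b\<in>R. ?f b \<in> U a} \<le> u" if "a \<in> R" for a
  proof -
    have "card {b\<in>R. ?f b \<in> U a} \<le> card (U a)"
      using Suc.prems(2)[of a] that R
      by (intro card_inj_on_le[where f = ?f]) (auto intro: inj_on_subset)
    then show ?thesis using Suc.prems(2)[of a] that R by auto
  qed
  then obtain T where T: "T \<subseteq> R" "\<forall>a\<in>T. \<forall>b\<in>T. a \<noteq> b \<longrightarrow> ?f b \<notin> U a"
    "card R \<le> (2 * u + 1) * card T"
    using exists_independent_subset[OF \<open>finite R\<close>, of "\<lambda>a b. ?f b \<in> U a" u] by blast
  \<comment> \<open>For distinct inputs in \<open>T\<close> the first cell of one is not flipped by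
    the other, so it still holds its content in \<open>m\<close>.\<close>
  have "(4 * u + 2) * card T \<le> F"
    using T R by (intro reduce[where c = "\<lambda>b. m (?f b)"]) (auto simp: flip_bits_def)
  then have "2 * card R \<le> F" using T by (simp add: algebra_simps)
  have "card S \<le> card (?f ` S) * (2 * F div (4 * u + 2))"
    using Suc.prems(1) fibre by (intro card_le_of_cover[where P = "\<lambda>i b. ?f b = i"]) auto
  also have "card (?f ` S) = card R"
    using R by (simp add: card_image)
  finally have "(4 * u + 2) * card S \<le> card R * ((4 * u + 2) * (2 * F div (4 * u + 2)))"
    by (metis mult.left_commute mult_le_mono2)
  also have "\<dots> \<le> card R * (2 * F)"
    by (intro mult_le_mono2) (rule times_div_less_eq_dividend)
  also have "\<dots> \<le> F * F"
    using \<open>2 * card R \<le> F\<close> mult_le_mono1[of "2 * card R" F F] by (simp add: ac_simps)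
  finally show ?case
    by (simp only: F_def power_Suc[of 2] mult_2[of "2 ^ q"] power_add)
qed

section \<open>The two lower bounds for schemes on \<open>{..<n}\<close>\<close>

lemma gt_scheme_le_probes:
  assumes "gt_scheme n u q U Q"
  shows "n \<le> (2 * q + 2) ^ u"
  using card_le_if_probes_le[of "{..<n}" U u Q zero_memory q] assms
  by (auto simp: gt_scheme_def)

lemma gt_scheme_le_flips:
  assumes "gt_scheme n u q U Q"
  shows "n \<le> (8 * u + 4) ^ (2 ^ q)"
proof -
  have "(4 * u + 2) * n \<le> (8 * u + 4) ^ (2 ^ q)"
    using card_le_if_flips_le[of "{..<n}" U u Q zero_memory q] assms
    by (auto simp: gt_scheme_def)
  then show ?thesis by (rule order.trans[rotated]) simp
qed

section \<open>Binary search and the two trie schemes\<close>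

text \<open>Binary search for the first set cell in a monotone range of \<open>2 ^ k\<close>
  indices, continuing with \<open>A\<close> at that index. Each probe reads the last cell of the
  left half; the last cell of the whole range is never read but presumed set.\<close>

primrec least_set :: "nat \<Rightarrow> nat \<Rightarrow> (nat \<Rightarrow> nat) \<Rightarrow> (nat \<Rightarrow> query_alg) \<Rightarrow> query_alg" where
  "least_set 0 lo c A = A lo"
| "least_set (Suc k) lo c A =
     Probe (c (lo + 2 ^ k - 1)) (least_set k (lo + 2 ^ k) c A) (least_set k lo c A)"

lemma least_set:
  assumes "lo \<le> j" "j < lo + 2 ^ k"
    and "\<And>i. lo \<le> i \<Longrightarrow> i < lo + 2 ^ k \<Longrightarrow> m (c i) \<longleftrightarrow> j \<le> i"
  shows "run (least_set k lo c A) m = run (A j) m"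
    and "probes (least_set k lo c A) m = k + probes (A j) m"
proof -
  have "run (least_set k lo c A) m = run (A j) m \<and>
    probes (least_set k lo c A) m = k + probes (A j) m"
    using assms
  proof (induction k arbitrary: lo)
    case 0
    then have "lo = j" by simp
    then show ?case by simp
  next
    case (Suc k)
    have "lo \<le> lo + 2 ^ k - 1 \<and> lo + 2 ^ k - 1 < lo + 2 ^ Suc k \<and>
        (j \<le> lo + 2 ^ k - 1 \<longleftrightarrow> j < lo + 2 ^ k)"
      using one_le_power[of "2 :: nat" k] unfolding power_Suc by linarith
    then have m: "m (c (lo + 2 ^ k - 1)) \<longleftrightarrow> j < lo + 2 ^ k"
      using Suc.prems(3)[of "lo + 2 ^ k - 1"] by blast
    show ?case
      using m Suc.prems Suc.IH[of lo] Suc.IH[of "lo + 2 ^ k"]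
      by (cases "j < lo + 2 ^ k") auto
  qed
  then show "run (least_set k lo c A) m = run (A j) m"
    and "probes (least_set k lo c A) m = k + probes (A j) m" by auto
qed

primrec any_set :: "nat list \<Rightarrow> query_alg" where
  "any_set [] = Answer False"
| "any_set (x # xs) = Probe x (any_set xs) (Answer True)"

lemma run_any_set: "run (any_set xs) m \<longleftrightarrow> (\<exists>x\<in>set xs. m x)"
  by (induction xs) auto

lemma probes_any_set: "probes (any_set xs) m \<le> length xs"
  by (induction xs) auto

text \<open>Node \<open>w\<close> of height \<open>i\<close> in the \<open>B\<close>-ary trie is the common prefix of the numbers \<open>x\<close> with
  \<open>x div B ^ i = w\<close>. Its first cell is set if \<open>a\<close> lies below it, its second cell if \<open>a\<close> lies
  below one of its smaller siblings.\<close>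

definition path_cell :: "nat \<Rightarrow> nat \<Rightarrow> nat" where
  "path_cell i w = 2 * prod_encode (i, w)"

definition right_cell :: "nat \<Rightarrow> nat \<Rightarrow> nat" where
  "right_cell i w = 2 * prod_encode (i, w) + 1"

lemma cell_eq_iff [simp]:
  "path_cell i w = path_cell j v \<longleftrightarrow> i = j \<and> w = v"
  "right_cell i w = right_cell j v \<longleftrightarrow> i = j \<and> w = v"
  "path_cell i w \<noteq> right_cell j v" "right_cell i w \<noteq> path_cell j v"
  unfolding path_cell_def right_cell_def by (simp_all, presburger+)

definition path_cells :: "nat \<Rightarrow> nat \<Rightarrow> nat \<Rightarrow> nat set" where
  "path_cells B k a = (\<lambda>i. path_cell i (a div B ^ i)) ` {..<2 ^ k}"

text \<open>The children of node \<open>w\<close> are \<open>B * w\<close>, ...,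
  \<open>B * w + B - 1\<close>, so the interval consists of the larger siblings of the ancestor of
  \<open>a\<close> at height \<open>i\<close>.\<close>

definition right_cells :: "nat \<Rightarrow> nat \<Rightarrow> nat \<Rightarrow> nat set" where
  "right_cells B k a = (\<lambda>(i, w). right_cell i w) `
     (SIGMA i:{..<2 ^ k}. {a div B ^ i <..< B * (a div B ^ Suc i) + B})"

text \<open>The search yields the lowest height \<open>j\<close> at which the ancestor of
  \<open>b\<close> is on the marked path. If \<open>j = 0\<close>, then \<open>b = a\<close>;
  otherwise the paths part at height \<open>j - 1\<close>, where the cells in \<open>cs\<close>
  decide the order. The two schemes differ only in \<open>cs\<close> and in the marked
  cells.\<close>

definition trie_query :: "nat \<Rightarrow> nat \<Rightarrow> (nat \<Rightarrow> nat list) \<Rightarrow> nat \<Rightarrow> query_alg" where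
  "trie_query B k cs b = least_set k 0 (\<lambda>i. path_cell i (b div B ^ i))
     (\<lambda>j. case j of 0 \<Rightarrow> Answer False | Suc i \<Rightarrow> any_set (cs i))"

text \<open>Agreement of ancestors is inherited upwards, so the search range is monotone; at its
  last height, \<open>2 ^ k - 1\<close>, all ancestors are \<open>0\<close>. Since division is
  monotone, the nodes just below the meeting point are ordered like \<open>a\<close> and
  \<open>b\<close>.\<close>

lemma trie_query_correct:
  assumes "B \<ge> 1" "a < n" "b < n" "n \<le> B ^ (2 ^ k - 1)"
    and path: "\<And>i w. i < 2 ^ k \<Longrightarrow> m (path_cell i w) \<longleftrightarrow> w = a div B ^ i"
    and len: "\<And>i. length (cs i) \<le> l"
    and cs: "\<And>i. Suc i < 2 ^ k \<Longrightarrow> b div B ^ i \<noteq> a div B ^ i \<Longrightarrow>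
      b div B ^ Suc i = a div B ^ Suc i \<Longrightarrow> (\<exists>x\<in>set (cs i). m x) \<longleftrightarrow> b div B ^ i > a div B ^ i"
  shows "probes (trie_query B k cs b) m \<le> k + l"
    and "run (trie_query B k cs b) m \<longleftrightarrow> b > a"
proof -
  define j where "j = (LEAST j. b div B ^ j = a div B ^ j)"
  have top: "b div B ^ (2 ^ k - 1) = a div B ^ (2 ^ k - 1)"
    using assms(2-4) by simp
  then have j: "b div B ^ j = a div B ^ j"
    unfolding j_def by (rule LeastI)
  have "j \<le> 2 ^ k - 1" unfolding j_def by (rule Least_le) (rule top)
  moreover have "(0::nat) < 2 ^ k" by simp
  ultimately have jk: "j < 2 ^ k" by linarith
  have "b div B ^ i = a div B ^ i \<longleftrightarrow> j \<le> i" for i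
  proof
    show "j \<le> i" if "b div B ^ i = a div B ^ i"
      unfolding j_def by (rule Least_le) (rule that)
    assume "j \<le> i"
    then have "B ^ i = B ^ j * B ^ (i - j)" by (simp flip: power_add)
    then show "b div B ^ i = a div B ^ i" using j by (simp add: div_mult2_eq)
  qed
  note same_iff = this
  let ?A = "\<lambda>j. case j of 0 \<Rightarrow> Answer False | Suc i \<Rightarrow> any_set (cs i)"
  have "run (trie_query B k cs b) m = run (?A j) m"
    "probes (trie_query B k cs b) m = k + probes (?A j) m"
    unfolding trie_query_def using least_set[of 0 j k m "\<lambda>i. path_cell i (b div B ^ i)" ?A] jk
    by (simp_all add: path same_iff)
  moreover have "probes (?A j) m \<le> l"
    using probes_any_set len by (auto split: nat.split intro: order.trans)
  moreover have "run (?A j) m \<longleftrightarrow> b > a"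
  proof (cases j)
    case (Suc i)
    have ne: "b div B ^ i \<noteq> a div B ^ i" using same_iff[of i] Suc by simp
    then have "b div B ^ i > a div B ^ i \<longleftrightarrow> b > a"
      using div_le_mono[of a b "B ^ i"] div_le_mono[of b a "B ^ i"] by linarith
    then show ?thesis
      using cs[of i] ne Suc j jk by (simp add: run_any_set)
  qed (use j in simp)
  ultimately show "probes (trie_query B k cs b) m \<le> k + l"
    and "run (trie_query B k cs b) m \<longleftrightarrow> b > a" by auto
qed

lemma ancestor_bounds:
  fixes B x i :: nat
  assumes "B \<ge> 1"
  shows "B * (x div B ^ Suc i) \<le> x div B ^ i" "x div B ^ i < B * (x div B ^ Suc i) + B"
proof -
  have "x div B ^ Suc i = x div B ^ i div B"
    unfolding power_Suc2 by (rule div_mult2_eq)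
  moreover have "x div B ^ i mod B < B" using assms by simp
  ultimately show "B * (x div B ^ Suc i) \<le> x div B ^ i" "x div B ^ i < B * (x div B ^ Suc i) + B"
    using mult_div_mod_eq[of B "x div B ^ i"] by (simp_all only:)
qed

lemma finite_card_path_cells: "finite (path_cells B k a)" "card (path_cells B k a) \<le> 2 ^ k"
  unfolding path_cells_def using card_image_le[of "{..<2 ^ k :: nat}"] by force+

lemma finite_card_right_cells:
  assumes "B \<ge> 1"
  shows "finite (right_cells B k a)" "card (right_cells B k a) \<le> 2 ^ k * (B - 1)"
proof -
  have "card {a div B ^ i <..< B * (a div B ^ Suc i) + B} \<le> B - 1" for i
    using ancestor_bounds(1)[OF assms, of a i] by simp
  then have "(\<Sum>i<2 ^ k. card {a div B ^ i <..< B * (a div B ^ Suc i) + B}) \<le> 2 ^ k * (B - 1)"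
    using sum_bounded_above[of "{..<2 ^ k :: nat}"
        "\<lambda>i. card {a div B ^ i <..< B * (a div B ^ Suc i) + B}" "B - 1"] by simp
  then show "card (right_cells B k a) \<le> 2 ^ k * (B - 1)"
    unfolding right_cells_def by (intro order.trans[OF card_image_le]) (auto simp: card_SigmaI)
  show "finite (right_cells B k a)" by (auto simp: right_cells_def)
qed

text \<open>Where the paths part, the node of \<open>a\<close> is a sibling of that of
  \<open>b\<close>. Hence \<open>b\<close> is larger iff a scan of the smaller siblings of its node
  meets the path.\<close>

lemma gt_scheme_few_flips:
  assumes "B \<ge> 1" "n \<le> B ^ (2 ^ k - 1)"
  shows "\<exists>U Q. gt_scheme n (2 ^ k) (k + B) U Q"
proof -
  define cs where "cs b i = map (path_cell i) [B * (b div B ^ Suc i)..<b div B ^ i]" for b i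
  have len: "length (cs b i) \<le> B" for b i
    using ancestor_bounds(2)[OF assms(1), of b i] by (simp add: cs_def)
  have "probes (trie_query B k (cs b) b) (flip_bits (path_cells B k a) zero_memory) \<le> k + B \<and>
    (run (trie_query B k (cs b) b) (flip_bits (path_cells B k a) zero_memory) \<longleftrightarrow> b > a)"
    if "a < n" "b < n" for a b
  proof -
    let ?m = "flip_bits (path_cells B k a) zero_memory"
    have path: "?m (path_cell i w) \<longleftrightarrow> w = a div B ^ i" if "i < 2 ^ k" for i w
      using that by (auto simp: flip_bits_def zero_memory_def path_cells_def)
    have "(\<exists>x\<in>set (cs b i). ?m x) \<longleftrightarrow> b div B ^ i > a div B ^ i"
      if "Suc i < 2 ^ k" "b div B ^ Suc i = a div B ^ Suc i" for i
    proof -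
      have "B * (b div B ^ Suc i) \<le> a div B ^ i"
        unfolding that(2) by (rule ancestor_bounds(1)[OF assms(1)])
      then show ?thesis using that(1) path[of i] by (auto simp: cs_def)
    qed
    then show ?thesis
      using trie_query_correct[OF assms(1) that assms(2), of ?m "cs b" B] path len by blast
  qed
  then show ?thesis
    unfolding gt_scheme_def using finite_card_path_cells
    by (intro exI[of _ "path_cells B k"] exI[of _ "\<lambda>b. trie_query B k (cs b) b"]) auto
qed

text \<open>The scan is replaced by one bit, prepared by the update: each of the
  \<open>2 ^ k\<close> levels costs one path cell and at most \<open>B - 1\<close> larger
  siblings.\<close>

lemma gt_scheme_few_probes:
  assumes "B \<ge> 1" "n \<le> B ^ (2 ^ k - 1)"
  shows "\<exists>U Q. gt_scheme n (B * 2 ^ k) (k + 1) U Q"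
proof -
  define cs where "cs b i = [right_cell i (b div B ^ i)]" for b i
  define U where "U a = path_cells B k a \<union> right_cells B k a" for a
  have "probes (trie_query B k (cs b) b) (flip_bits (U a) zero_memory) \<le> k + 1 \<and>
    (run (trie_query B k (cs b) b) (flip_bits (U a) zero_memory) \<longleftrightarrow> b > a)"
    if "a < n" "b < n" for a b
  proof -
    let ?m = "flip_bits (U a) zero_memory"
    have path: "?m (path_cell i w) \<longleftrightarrow> w = a div B ^ i" if "i < 2 ^ k" for i w
      using that by (auto simp: flip_bits_def zero_memory_def U_def path_cells_def right_cells_def)
    have "(\<exists>x\<in>set (cs b i). ?m x) \<longleftrightarrow> b div B ^ i > a div B ^ i"
      if "Suc i < 2 ^ k" "b div B ^ Suc i = a div B ^ Suc i" for i
    proof -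
      have "b div B ^ i < B * (a div B ^ Suc i) + B"
        unfolding that(2)[symmetric] by (rule ancestor_bounds(2)[OF assms(1)])
      then show ?thesis
        using that(1)
        by (force simp: flip_bits_def zero_memory_def U_def cs_def path_cells_def right_cells_def)
    qed
    then show ?thesis
      using trie_query_correct[OF assms(1) that assms(2), of ?m "cs b" 1] path
      by (auto simp: cs_def)
  qed
  moreover have "finite (U a) \<and> card (U a) \<le> B * 2 ^ k" for a
  proof -
    have "card (U a) \<le> 2 ^ k + 2 ^ k * (B - 1)"
      unfolding U_def using finite_card_path_cells finite_card_right_cells[OF assms(1)]
      by (intro order.trans[OF card_Un_le] add_mono) auto
    also have "\<dots> = B * 2 ^ k" using assms(1) by (cases B) auto
    finally show ?thesis
      using finite_card_path_cells finite_card_right_cells[OF assms(1)] by (simp add: U_def)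
  qed
  ultimately show ?thesis
    unfolding gt_scheme_def
    by (intro exI[of _ U] exI[of _ "\<lambda>b. trie_query B k (cs b) b"]) auto
qed

section \<open>Height of the trie\<close>

text \<open>The number of levels is rounded to a power of two, and its exponent is the length of the
  binary search.\<close>

definition trie_height_log :: "nat \<Rightarrow> nat \<Rightarrow> nat" where
  "trie_height_log B n = (LEAST k. n \<le> B ^ (2 ^ k - 1))"

text \<open>The exponent \<open>n\<close> always suffices. By minimality the exponent
  \<open>k\<close> just below the least one fails, so \<open>2 ^ k - 1\<close> is at most the
  base-\<open>B\<close> logarithm of \<open>n\<close>; doubling gives the bound.\<close>

lemma trie_height_log:
  assumes "B \<ge> 2"
  shows "n \<le> B ^ (2 ^ trie_height_log B n - 1)"
    and "n \<ge> 1 \<Longrightarrow> 2 ^ trie_height_log B n \<le> 2 * ln (real n) / ln (real B) + 2"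
proof -
  have "n \<le> B ^ n"
    using assms by (meson less_exp less_or_eq_imp_le order_trans power_mono zero_le)
  also have "\<dots> \<le> B ^ (2 ^ n - 1)"
    using assms less_exp[of n] by (intro power_increasing) linarith+
  finally show "n \<le> B ^ (2 ^ trie_height_log B n - 1)"
    unfolding trie_height_log_def by (rule LeastI)
  assume n: "n \<ge> 1"
  have lnB: "ln (real B) > 0" using assms by simp
  show "2 ^ trie_height_log B n \<le> 2 * ln (real n) / ln (real B) + 2"
  proof (cases "trie_height_log B n")
    case 0
    then show ?thesis using n lnB by simp
  next
    case (Suc k)
    have "B ^ (2 ^ k - 1) < n"
      using not_less_Least[of k "\<lambda>k. n \<le> B ^ (2 ^ k - 1)"] Suc by (simp add: trie_height_log_def)
    then have "real B ^ (2 ^ k - 1) \<le> real n"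
      by (metis less_imp_le of_nat_le_iff of_nat_power)
    then have "ln (real B ^ (2 ^ k - 1)) \<le> ln (real n)"
      using assms n by (subst ln_le_cancel_iff) auto
    then have "real (2 ^ k - 1) * ln (real B) \<le> ln (real n)"
      using assms by (simp add: ln_realpow)
    then have "2 ^ k - 1 \<le> ln (real n) / ln (real B)"
      using lnB by (simp add: field_simps of_nat_diff)
    then show ?thesis using Suc by simp
  qed
qed

lemma gt_costs_few_flips:
  assumes "\<And>n. B n \<ge> 2"
  shows "gt_costs (\<lambda>n. 2 ^ trie_height_log (B n) n) (\<lambda>n. trie_height_log (B n) n + B n)"
  unfolding gt_costs_def
  using gt_scheme_few_flips trie_height_log(1) assms by (meson le_trans one_le_numeral)

lemma gt_costs_few_probes:
  assumes "\<And>n. B n \<ge> 2"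
  shows "gt_costs (\<lambda>n. B n * 2 ^ trie_height_log (B n) n) (\<lambda>n. trie_height_log (B n) n + 1)"
  unfolding gt_costs_def
  using gt_scheme_few_probes trie_height_log(1) assms by (meson le_trans one_le_numeral)

lemma trie_height_log_le_log2:
  assumes "B \<ge> 2" "n \<ge> 2"
  shows "2 ^ trie_height_log B n \<le> 4 * log 2 (real n)"
proof -
  have "ln (real n) / ln (real B) \<le> ln (real n) / ln 2"
    using assms by (intro divide_left_mono) auto
  moreover have "1 \<le> log 2 (real n)" using assms by (simp add: le_log_iff)
  moreover have "2 ^ trie_height_log B n \<le> 2 * (ln (real n) / ln (real B)) + 2"
    using trie_height_log(2)[of B n] assms by simp
  ultimately show ?thesis unfolding log_def by linarith
qed

section \<open>Asymptotic notation and growth of logarithms\<close>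

lemma bigo_eventually_le:
  fixes f g :: "nat \<Rightarrow> real"
  assumes "f \<in> O(g)" "\<forall>\<^sub>F n in sequentially. 0 \<le> g n"
  obtains C where "C > 0" "\<forall>\<^sub>F n in sequentially. f n \<le> C * g n"
proof -
  obtain C where C: "C > 0" "\<forall>\<^sub>F n in sequentially. norm (f n) \<le> C * norm (g n)"
    using assms(1) by (elim landau_o.bigE)
  have "\<forall>\<^sub>F n in sequentially. f n \<le> C * g n"
    using C(2) assms(2) by eventually_elim auto
  with C(1) that show ?thesis by blast
qed

lemma bigo_eventually_leI:
  fixes f g :: "nat \<Rightarrow> real"
  assumes "\<forall>\<^sub>F n in sequentially. 0 \<le> f n \<and> f n \<le> C * g n"
  shows "f \<in> O(g)"
proof (rule bigoI)
  show "\<forall>\<^sub>F n in sequentially. norm (f n) \<le> \<bar>C\<bar> * norm (g n)"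
    using assms
  proof eventually_elim
    case (elim n)
    then have "norm (f n) = \<bar>f n\<bar>" "\<bar>f n\<bar> \<le> \<bar>C * g n\<bar>" by auto
    then show ?case by (simp add: abs_mult)
  qed
qed

lemma bigomega_eventually_leI:
  fixes f g :: "nat \<Rightarrow> real"
  assumes "\<forall>\<^sub>F n in sequentially. 0 \<le> g n \<and> g n \<le> C * f n"
  shows "f \<in> \<Omega>(g)"
  using bigo_eventually_leI[OF assms] by (simp add: bigomega_iff_bigo)

lemma filterlim_log2_at_top: "filterlim (log 2) at_top at_top"
proof -
  have "filterlim (\<lambda>x. 1 / ln 2 * ln x :: real) at_top at_top"
    by (intro filterlim_tendsto_pos_mult_at_top[OF tendsto_const _ ln_at_top]) simp
  then show ?thesis by (simp add: log_def[abs_def])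
qed

lemma filterlim_log2_nat: "filterlim (\<lambda>n. log 2 (real n)) at_top sequentially"
  by (intro filterlim_compose[OF filterlim_log2_at_top filterlim_real_sequentially])

lemma filterlim_log2_log2_nat: "filterlim (\<lambda>n. log 2 (log 2 (real n))) at_top sequentially"
  by (intro filterlim_compose[OF filterlim_log2_at_top filterlim_log2_nat])

section \<open>Tradeoff for few flips\<close>

lemma few_flips_achievable:
  assumes Tu: "\<forall>\<^sub>F n in sequentially. Tu n \<ge> 1"
    and Tq: "\<forall>\<^sub>F n in sequentially. Tq n \<ge> log 2 (log 2 (real n))"
    and bound: "Tu \<in> \<Omega>(\<lambda>n. log (Tq n) (real n))"
  shows "gt_achievable Tu Tq"
proof -
  \<comment> \<open>The scan may cost as much as the whole probe budget.\<close>
  define B where "B n = max 2 (nat \<lfloor>Tq n\<rfloor>)" for n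
  have B2: "B n \<ge> 2" for n by (simp add: B_def)
  define k where "k n = trie_height_log (B n) n" for n
  have large: "\<forall>\<^sub>F n in sequentially. log 2 (log 2 (real n)) \<ge> 4 \<and> n \<ge> 2"
    using filterlim_log2_log2_nat eventually_ge_at_top[of 2]
    by (auto simp: filterlim_at_top eventually_conj_iff)
  obtain K where K: "K > 0" "\<forall>\<^sub>F n in sequentially. log (Tq n) (real n) \<le> K * Tu n"
  proof (rule bigo_eventually_le)
    show "(\<lambda>n. log (Tq n) (real n)) \<in> O(Tu)" using bound by (simp add: bigomega_iff_bigo)
    show "\<forall>\<^sub>F n in sequentially. 0 \<le> Tu n" using Tu by eventually_elim simp
  qed
  have "(\<lambda>n. real (2 ^ k n)) \<in> O(Tu)"
  proof (rule bigo_eventually_leI[where C = "4 * K + 2"])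
    show "\<forall>\<^sub>F n in sequentially. 0 \<le> real (2 ^ k n) \<and> real (2 ^ k n) \<le> (4 * K + 2) * Tu n"
      using large Tu Tq K(2)
    proof eventually_elim
      case (elim n)
      then have T4: "Tq n \<ge> 4" by linarith
      \<comment> \<open>Only the logarithm of \<open>B n\<close> matters, so the crude bound
        \<open>sqrt (Tq n) \<le> B n\<close>, which survives the rounding, costs just a factor of
        two.\<close>
      have "2 * sqrt (Tq n) \<le> sqrt (Tq n) * sqrt (Tq n)"
        using T4 by (intro mult_right_mono) (auto simp: real_le_rsqrt)
      moreover have "Tq n - 1 \<le> real (B n)"
        unfolding B_def using T4 by linarith
      ultimately have "sqrt (Tq n) \<le> real (B n)" using T4 by simp
      then have "ln (sqrt (Tq n)) \<le> ln (real (B n))"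
        using T4 B2[of n] by (subst ln_le_cancel_iff) auto
      then have "ln (Tq n) / 2 \<le> ln (real (B n))" using T4 by (simp add: ln_sqrt)
      then have "ln (real n) / ln (real (B n)) \<le> ln (real n) / (ln (Tq n) / 2)"
        using T4 elim B2[of n] by (intro divide_left_mono) auto
      also have "\<dots> = 2 * log (Tq n) (real n)" by (simp add: log_def)
      finally have "2 ^ k n \<le> 4 * log (Tq n) (real n) + 2"
        using trie_height_log(2)[OF B2, of n n] elim by (simp add: k_def)
      also have "\<dots> \<le> 4 * (K * Tu n) + 2 * Tu n" using elim by simp
      finally show ?case by (simp add: algebra_simps)
    qed
  qed
  moreover have "(\<lambda>n. real (k n + B n)) \<in> O(Tq)"
  proof (rule bigo_eventually_leI[where C = 3])
    show "\<forall>\<^sub>F n in sequentially. 0 \<le> real (k n + B n) \<and> real (k n + B n) \<le> 3 * Tq n"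
      using large Tq
    proof eventually_elim
      case (elim n)
      then have T4: "Tq n \<ge> 4" by linarith
      have "log 2 (real n) > 0" using elim by simp
      \<comment> \<open>The binary search takes at most \<open>2 + log 2 (log 2 n)\<close> probes,
        which fits the budget in this regime.\<close>
      have "log 2 (2 ^ k n) \<le> log 2 (4 * log 2 (real n))"
        using trie_height_log_le_log2[OF B2, of n n] elim
        by (subst log_le_cancel_iff) (auto simp: k_def)
      also have "\<dots> = log 2 4 + log 2 (log 2 (real n))"
        using \<open>log 2 (real n) > 0\<close> by (simp add: log_mult)
      also have "log 2 4 = (2::real)" using log_pow_cancel[of "2::real" 2] by simp
      finally have "real (k n) \<le> 2 + Tq n" using elim by simp
      moreover have "real (B n) \<le> Tq n" unfolding B_def using T4 by linarith
      ultimately show ?case using T4 by simp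
    qed
  qed
  ultimately show ?thesis
    unfolding gt_achievable_def using gt_costs_few_flips[of B, OF B2] unfolding k_def by blast
qed

text \<open>\<open>Tq\<close> tends to infinity, so \<open>2 * q n + 2 \<le> Tq n ^ 2\<close>
  eventually. The hidden constant of \<open>q\<close> thus costs only a factor of two once
  logarithms are taken in \<open>n \<le> (2 * q n + 2) ^ u n\<close>.\<close>

lemma few_flips_necessary:
  assumes Tu: "\<forall>\<^sub>F n in sequentially. Tu n \<ge> 1"
    and Tq: "\<forall>\<^sub>F n in sequentially. Tq n \<ge> log 2 (log 2 (real n))"
    and "gt_achievable Tu Tq"
  shows "Tu \<in> \<Omega>(\<lambda>n. log (Tq n) (real n))"
proof -
  obtain u q where costs: "gt_costs u q"
    and "(\<lambda>n. real (u n)) \<in> O(Tu)" "(\<lambda>n. real (q n)) \<in> O(Tq)"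
    using assms(3) by (auto simp: gt_achievable_def)
  have "\<forall>\<^sub>F n in sequentially. 0 \<le> Tu n" using Tu by eventually_elim simp
  then obtain C where C: "C > 0" "\<forall>\<^sub>F n in sequentially. real (u n) \<le> C * Tu n"
    using bigo_eventually_le[OF \<open>(\<lambda>n. real (u n)) \<in> O(Tu)\<close>] by blast
  have Tq_ge: "\<forall>\<^sub>F n in sequentially. Tq n \<ge> c" for c
    using filterlim_at_top_mono[OF filterlim_log2_log2_nat Tq] by (auto simp: filterlim_at_top)
  then obtain D where D: "D > 0" "\<forall>\<^sub>F n in sequentially. real (q n) \<le> D * Tq n"
    using bigo_eventually_le[OF \<open>(\<lambda>n. real (q n)) \<in> O(Tq)\<close>] by blast
  show ?thesis
  proof (rule bigomega_eventually_leI[where C = "2 * C"])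
    show "\<forall>\<^sub>F n in sequentially. 0 \<le> log (Tq n) (real n) \<and> log (Tq n) (real n) \<le> 2 * C * Tu n"
      using Tq_ge[of "2 * D + 2"] C(2) D(2) eventually_ge_at_top[of 1]
    proof eventually_elim
      case (elim n)
      have T2: "Tq n > 1" using elim D(1) by linarith
      have "real (2 * q n + 2) \<le> 2 * (D * Tq n) + 2 * Tq n"
        using elim T2 by simp
      also have "\<dots> = (2 * D + 2) * Tq n" by (simp add: algebra_simps)
      also have "\<dots> \<le> Tq n ^ 2"
        unfolding power2_eq_square using elim T2 by (intro mult_right_mono) auto
      finally have "ln (real (2 * q n + 2)) \<le> ln (Tq n ^ 2)"
        using T2 by (subst ln_le_cancel_iff) auto
      then have lnq: "ln (real (2 * q n + 2)) \<le> 2 * ln (Tq n)"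
        using T2 by (simp add: ln_realpow)
      have "n \<le> (2 * q n + 2) ^ u n"
        using costs gt_scheme_le_probes unfolding gt_costs_def by blast
      then have "real n \<le> real (2 * q n + 2) ^ u n" by (metis of_nat_le_iff of_nat_power)
      then have "ln (real n) \<le> ln (real (2 * q n + 2) ^ u n)"
        using elim by (subst ln_le_cancel_iff) auto
      also have "\<dots> = real (u n) * ln (real (2 * q n + 2))" by (simp add: ln_realpow)
      also have "\<dots> \<le> (C * Tu n) * (2 * ln (Tq n))"
        using lnq elim by (intro mult_mono) auto
      finally show ?case
        using T2 elim by (simp add: log_def field_simps)
    qed
  qed
qed

section \<open>Tradeoff for few probes\<close>

lemma few_probes_achievable:
  assumes Tq: "\<forall>\<^sub>F n in sequentially. Tq n \<ge> 1"
    and Tu: "\<forall>\<^sub>F n in sequentially. Tu n \<ge> log 2 (real n)"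
    and bound: "(\<lambda>n. 2 powr Tq n) \<in> \<Omega>(\<lambda>n. log (Tu n) (real n))"
  shows "gt_achievable Tu Tq"
proof -
  \<comment> \<open>The flips number at most \<open>B n\<close> times \<open>4 * log 2 n\<close>. If
    \<open>log 2 n \<le> sqrt (Tu n)\<close>, a degree up to \<open>sqrt (Tu n)\<close> is
    affordable; otherwise a binary trie is used.\<close>
  define B where "B n = (if Tu n \<ge> log 2 (real n) ^ 2 then max 2 (nat \<lfloor>sqrt (Tu n)\<rfloor>) else 2)" for n
  have B2: "B n \<ge> 2" for n by (simp add: B_def)
  define k where "k n = trie_height_log (B n) n" for n
  have large: "\<forall>\<^sub>F n in sequentially. log 2 (real n) \<ge> 16 \<and> n \<ge> 2"
    using filterlim_log2_nat eventually_ge_at_top[of 2]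
    by (auto simp: filterlim_at_top eventually_conj_iff)
  obtain K where K: "K > 0" "\<forall>\<^sub>F n in sequentially. log (Tu n) (real n) \<le> K * 2 powr Tq n"
  proof (rule bigo_eventually_le)
    show "(\<lambda>n. log (Tu n) (real n)) \<in> O(\<lambda>n. 2 powr Tq n)"
      using bound by (simp add: bigomega_iff_bigo)
  qed auto
  have "(\<lambda>n. real (B n * 2 ^ k n)) \<in> O(Tu)"
  proof (rule bigo_eventually_leI[where C = 8])
    show "\<forall>\<^sub>F n in sequentially. 0 \<le> real (B n * 2 ^ k n) \<and> real (B n * 2 ^ k n) \<le> 8 * Tu n"
      using large Tu
    proof eventually_elim
      case (elim n)
      have height: "2 ^ k n \<le> 4 * log 2 (real n)"
        using trie_height_log_le_log2[OF B2, of n n] elim by (simp add: k_def)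
      show ?case
      proof (cases "Tu n \<ge> log 2 (real n) ^ 2")
        case True
        have sqrt: "log 2 (real n) \<le> sqrt (Tu n)" using True elim by (simp add: real_le_rsqrt)
        then have "real (B n) \<le> sqrt (Tu n)" unfolding B_def using True elim by simp linarith
        then have "real (B n) * 2 ^ k n \<le> sqrt (Tu n) * (4 * sqrt (Tu n))"
          using sqrt height elim by (intro mult_mono) auto
        also have "\<dots> = 4 * Tu n" using elim by simp
        finally show ?thesis using elim by simp
      next
        case False
        then show ?thesis using height elim by (simp add: B_def)
      qed
    qed
  qed
  \<comment> \<open>\<open>8 * K + 2\<close> serves the wide trie, \<open>256 * K\<^sup>2\<close>
    the binary one.\<close>
  moreover define M where "M = 256 * K\<^sup>2 + 8 * K + 2"
  have M1: "M \<ge> 1" using K(1) by (simp add: M_def)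
  have "(\<lambda>n. real (k n + 1)) \<in> O(Tq)"
  proof (rule bigo_eventually_leI[where C = "log 2 M + 3"])
    show "\<forall>\<^sub>F n in sequentially. 0 \<le> real (k n + 1) \<and> real (k n + 1) \<le> (log 2 M + 3) * Tq n"
      using large Tu Tq K(2)
    proof eventually_elim
      case (elim n)
      define L where "L = log 2 (real n)"
      have L: "L \<ge> 16" "L \<le> Tu n" using elim by (auto simp: L_def)
      define X where "X = 2 powr Tq n"
      have X1: "X \<ge> 1" using elim by (simp add: X_def ge_one_powr_ge_zero)
      have XX: "X \<le> X\<^sup>2" "1 \<le> X\<^sup>2"
        using X1 by (auto intro: self_le_power one_le_power)
      \<comment> \<open>The square is harmless: after taking logarithms it only doubles
        \<open>Tq n\<close>.\<close>
      have "2 ^ k n \<le> M * X\<^sup>2"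
      proof (cases "Tu n \<ge> L ^ 2")
        case True
        have sqrt: "4 \<le> sqrt (Tu n)" using L by (simp add: real_le_rsqrt)
        have "2 * sqrt (sqrt (Tu n)) \<le> sqrt (sqrt (Tu n)) * sqrt (sqrt (Tu n))"
          using sqrt L by (intro mult_right_mono) (auto simp: real_le_rsqrt)
        moreover have "sqrt (Tu n) - 1 \<le> real (B n)"
          unfolding B_def using True sqrt by (simp add: L_def) linarith
        ultimately have "sqrt (sqrt (Tu n)) \<le> real (B n)" using sqrt L by simp
        then have "ln (sqrt (sqrt (Tu n))) \<le> ln (real (B n))"
          using sqrt L B2[of n] by (subst ln_le_cancel_iff) auto
        then have "ln (Tu n) / 4 \<le> ln (real (B n))" using L by (simp add: ln_sqrt)
        then have "ln (real n) / ln (real (B n)) \<le> ln (real n) / (ln (Tu n) / 4)"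
          using L elim B2[of n] by (intro divide_left_mono) auto
        also have "\<dots> = 4 * log (Tu n) (real n)" by (simp add: log_def)
        finally have "2 ^ k n \<le> 8 * log (Tu n) (real n) + 2"
          using trie_height_log(2)[OF B2, of n n] elim by (simp add: k_def)
        also have "\<dots> \<le> 8 * (K * X) + 2" using elim by (simp add: X_def)
        also have "\<dots> \<le> 8 * (K * X\<^sup>2) + 2 * X\<^sup>2 + 256 * K\<^sup>2 * X\<^sup>2"
          using XX K(1) by (intro add_increasing2 add_mono mult_left_mono) auto
        finally show ?thesis by (simp add: M_def algebra_simps)
      next
        case False
        have half: "1 / 2 \<le> ln (2::real)" using ln_le_minus_one[of "1/2"] by (simp add: ln_div)
        \<comment> \<open>With \<open>ln (Tu n) \<le> 4 * sqrt L\<close>, the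
          base-\<open>Tu n\<close> logarithm of \<open>n\<close> is at least of order
          \<open>sqrt L\<close>. The hypothesis then forces \<open>X\<close> to be at least of that
          order, so the \<open>4 * L\<close> levels of the binary trie are within
          \<open>X\<^sup>2\<close> up to a constant.\<close>
        have "ln (Tu n) \<le> ln (L ^ 2)"
          using False L by (subst ln_le_cancel_iff) auto
        also have "\<dots> = 4 * ln (sqrt L)" using L by (simp add: ln_realpow ln_sqrt)
        also have "\<dots> \<le> 4 * sqrt L" using L less_imp_le[OF ln_less_self, of "sqrt L"] by simp
        finally have lnTu: "ln (Tu n) \<le> 4 * sqrt L" .
        have cancel: "(s * s) * ln 2 / (4 * s) = s * ln 2 / 4" if "s > 0" for s :: real
          using that by (simp add: field_simps)
        have ss: "sqrt L * sqrt L = L" using L by simp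
        have "log (Tu n) (real n) = (sqrt L * sqrt L) * ln 2 / ln (Tu n)"
          unfolding ss by (simp add: L_def log_def)
        also have "\<dots> \<ge> (sqrt L * sqrt L) * ln 2 / (4 * sqrt L)"
          using L lnTu by (intro divide_left_mono) auto
        also have "(sqrt L * sqrt L) * ln 2 / (4 * sqrt L) = sqrt L * ln 2 / 4"
          by (rule cancel) (use L in simp)
        finally have "sqrt L * ln 2 / 4 \<le> K * X" using elim by (simp add: X_def)
        moreover have "sqrt L * (1 / 2) \<le> sqrt L * ln 2"
          using half L by (intro mult_left_mono) auto
        ultimately have "sqrt L \<le> 8 * (K * X)" by simp
        then have "sqrt L ^ 2 \<le> (8 * (K * X)) ^ 2" using L by (intro power_mono) auto
        then have "L \<le> 64 * K\<^sup>2 * X\<^sup>2" using L by (simp add: power_mult_distrib)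
        moreover have "2 ^ k n \<le> 4 * L"
          using trie_height_log_le_log2[OF B2, of n n] elim by (simp add: k_def L_def)
        moreover have "0 \<le> (8 * K + 2) * X\<^sup>2" using K(1) by simp
        ultimately show ?thesis by (simp add: M_def algebra_simps)
      qed
      then have "log 2 (2 ^ k n) \<le> log 2 (M * X\<^sup>2)"
        by (intro log_mono) auto
      also have "\<dots> = log 2 M + 2 * Tq n"
        using M1 X1 by (simp add: log_mult log_nat_power X_def)
      also have "\<dots> \<le> log 2 M * Tq n + 2 * Tq n"
        using M1 elim by (simp add: mult_le_cancel_left1)
      finally show ?case using elim by (simp add: algebra_simps)
    qed
  qed
  ultimately show ?thesis
    unfolding gt_achievable_def using gt_costs_few_probes[of B, OF B2] unfolding k_def by blast
qed

text \<open>\<open>Tu\<close> tends to infinity, so \<open>8 * u n + 4 \<le> Tu n ^ 2\<close>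
  eventually; take logarithms in \<open>n \<le> (8 * u n + 4) ^ (2 ^ q n)\<close>.\<close>

lemma few_probes_necessary:
  assumes Tu: "\<forall>\<^sub>F n in sequentially. Tu n \<ge> log 2 (real n)"
    and costs: "gt_costs u q" and "(\<lambda>n. real (u n)) \<in> O(Tu)"
  shows "(\<lambda>n. 2 powr real (q n)) \<in> \<Omega>(\<lambda>n. log (Tu n) (real n))"
proof -
  have Tu_ge: "\<forall>\<^sub>F n in sequentially. Tu n \<ge> c" for c
    using filterlim_at_top_mono[OF filterlim_log2_nat Tu] by (auto simp: filterlim_at_top)
  then obtain C where C: "C > 0" "\<forall>\<^sub>F n in sequentially. real (u n) \<le> C * Tu n"
    using bigo_eventually_le[OF assms(3)] by blast
  show ?thesis
  proof (rule bigomega_eventually_leI[where C = 2])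
    show "\<forall>\<^sub>F n in sequentially. 0 \<le> log (Tu n) (real n) \<and>
        log (Tu n) (real n) \<le> 2 * 2 powr real (q n)"
      using Tu_ge[of "8 * C + 4"] C(2) eventually_ge_at_top[of 1]
    proof eventually_elim
      case (elim n)
      have T2: "Tu n > 1" using elim C(1) by linarith
      have "real (8 * u n + 4) \<le> 8 * (C * Tu n) + 4 * Tu n"
        using elim T2 by simp
      also have "\<dots> = (8 * C + 4) * Tu n" by (simp add: algebra_simps)
      also have "\<dots> \<le> Tu n ^ 2"
        unfolding power2_eq_square using elim T2 by (intro mult_right_mono) auto
      finally have "ln (real (8 * u n + 4)) \<le> ln (Tu n ^ 2)"
        using T2 by (subst ln_le_cancel_iff) auto
      then have lnu: "ln (real (8 * u n + 4)) \<le> 2 * ln (Tu n)"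
        using T2 by (simp add: ln_realpow)
      have "n \<le> (8 * u n + 4) ^ (2 ^ q n)"
        using costs gt_scheme_le_flips unfolding gt_costs_def by blast
      then have "real n \<le> real (8 * u n + 4) ^ (2 ^ q n)" by (metis of_nat_le_iff of_nat_power)
      then have "ln (real n) \<le> ln (real (8 * u n + 4) ^ (2 ^ q n))"
        using elim by (subst ln_le_cancel_iff) auto
      also have "\<dots> = 2 ^ q n * ln (real (8 * u n + 4))" by (simp add: ln_realpow)
      also have "\<dots> \<le> 2 ^ q n * (2 * ln (Tu n))"
        using lnu by (intro mult_left_mono) auto
      finally show ?case
        using T2 elim by (simp add: log_def field_simps powr_realpow)
    qed
  qed
qed

text \<open>Constant factors in \<open>Tq\<close> become powers of \<open>2 powr Tq n\<close>. In
  the second regime achievability is therefore up to a constant factor in the probes, while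
  necessity speaks of the exact probe count \<open>q\<close>.\<close>

theorem theorem3:
  fixes Tu Tq :: "nat \<Rightarrow> real"
  assumes "\<forall>\<^sub>F n in sequentially. Tu n \<ge> 1"
    and "\<forall>\<^sub>F n in sequentially. Tq n \<ge> 1"
  shows "((\<forall>\<^sub>F n in sequentially.
             Tq n \<ge> log 2 (log 2 (real n)) \<and> Tu n \<le> log 2 (real n)) \<longrightarrow>
           (gt_achievable Tu Tq \<longleftrightarrow> Tu \<in> \<Omega>(\<lambda>n. log (Tq n) (real n))))
       \<and> ((\<forall>\<^sub>F n in sequentially.
             Tq n \<le> log 2 (log 2 (real n)) \<and> Tu n \<ge> log 2 (real n)) \<longrightarrow>
           ((\<lambda>n. 2 powr Tq n) \<in> \<Omega>(\<lambda>n. log (Tu n) (real n)) \<longrightarrow> gt_achievable Tu Tq) \<and>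
           (\<forall>u q. gt_costs u q \<and> (\<lambda>n. real (u n)) \<in> O(Tu) \<and> (\<lambda>n. real (q n)) \<in> O(Tq) \<longrightarrow>
              (\<lambda>n. 2 powr real (q n)) \<in> \<Omega>(\<lambda>n. log (Tu n) (real n))))"
  using few_flips_achievable[of Tu Tq] few_flips_necessary[of Tu Tq]
    few_probes_achievable[of Tq Tu] few_probes_necessary[of Tu] assms
  by (auto simp: eventually_conj_iff)

end
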